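(* Let $q$ be an odd prime power and let $\mathcal X$ be the Passman scheme of degree $q^2$. Then $s(\mathcal X)\le 3$, where $s(\mathcal X)$ is the separability number of $\mathcal X$.
   Context: **Coherent configurations.** Let $\Omega$ be a finite set and $S$ a partition of $\Omega\times\Omega$. Write $S^\cup$ for the set of all unions of elements of $S$, $1_\Omega$ for the diagonal of $\Omega\times\Omega$, $s^*=\{(\beta,\alpha):(\alpha,\beta)\in s\}$, and $\alpha s=\{\beta:(\alpha,\beta)\in s\}$. The pair $\mathcal X=(\Omega,S)$ is a coherent configuration if $1_\Omega\in S^\cup$, $s^*\in S$ for all $s\in S$, and for all $r,s,t\in S$ the number $c_{rs}^t=|\alpha r\cap\beta s^*|$ does not depend on the choice of $(\alpha,\beta)\in t$ (the $c_{rs}^t$ are the intersection numbers). Elements of $S$ are basis relations, elements of $S^\cup$ are relations of $\mathcal X$; $|\Omega|$ is the degree. A fiber of $\mathcal X$ is a set $\Delta\subseteq\Omega$ with $1_\Delta\in S$. A scheme is a coherent configuration with $1_\Omega\in S$. For rainbows on the same set (pairs $(\Omega,S)$ satisfying only $1_\Omega\in S^\cup$ and $S^*=S$), $\mathcal X\le\mathcal X'$ means $S(\mathcal X)^\cup\subseteq S(\mathcal X')^\cup$; "smallest" refers to this order. For a permutation group $G$ on $\Omega$, $\mathrm{Inv}(G)$ is the coherent configuration on $\Omega$ whose basis relations are the orbits of $G$ on $\Omega\times\Omega$. **Isomorphisms.** An isomorphism from $\mathcal X=(\Omega,S)$ to $\mathcal X'=(\Omega',S')$ is a bijection $f:\Omega\to\Omega'$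 with $S^f=S'$. An algebraic isomorphism is a bijection $\varphi:S\to S'$ with $c_{rs}^t=c_{\varphi(r)\varphi(s)}^{\varphi(t)}$ for all $r,s,t\in S$; it extends to a bijection $S^\cup\to(S')^\cup$ by taking unions. It is induced by an isomorphism $f$ if $\varphi(s)=s^f$ for all $s\in S$. **Separability number.** Let $m\ge1$. The Cartesian $m$-power of $\mathcal X$ is the coherent configuration on $\Omega^m$ with basis relations $s_1\otimes\cdots\otimes s_m=\{((\alpha_1,\dots,\alpha_m),(\beta_1,\dots,\beta_m)):(\alpha_i,\beta_i)\in s_i\text{ for all }i\}$, $s_i\in S$. The $m$-extension of $\mathcal X$ is the smallest coherent configuration on $\Omega^m$ that contains (is $\ge$) the Cartesian $m$-power of $\mathcal X$ and for which $\mathrm{Diag}(\Omega^m)=\{(\alpha,\dots,\alpha):\alpha\in\Omega\}$ is a union of fibers. An algebraic isomorphism $\varphi$ from $\mathcal X$ to $\mathcal X'$ is $m$-dimensional if it can be extended to an algebraic isomorphism $\hat\varphi$ from the $m$-extension of $\mathcal X$ to that of $\mathcal X'$ (so $\hat\varphi(s_1\otimes\cdots\otimes s_m)=\varphi(s_1)\otimes\cdots\otimes\varphi(s_m)$) taking $\mathrm{Diag}(\Omega^m)$ to $\mathrm{Diag}((\Omega')^m)$, i.e. $\hat\varphi(1_{\mathrm{Diag}(\Omega^m)})=1_{\mathrm{Diag}((\Omega')^m)}$. The separability number $s(\mathcal X)$ is the smallest positive integer $m$ such that every $m$-dimensional algebraic isomorphism from $\mathcal X$ (to any coherent configuration) is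 induced by some isomorphism. **Passman scheme.** Let $q$ be an odd prime power. Let $G\le\mathrm{AGL}(2,q)$ be the group of permutations of $\Omega=\mathbb F_q^2$ generated by all translations and all monomial $2\times2$ matrices over $\mathbb F_q$ with determinant $\pm1$ (so the stabilizer of the zero vector consists of these matrices and has order $4(q-1)$). The Passman scheme of degree $q^2$ is $\mathrm{Inv}(G)$. *)

theory Defs
  imports
    "HOL-Analysis.Analysis"
    "HOL-Library.Disjoint_Sets"
    "HOL-Algebra.Bij"
    "HOL-Algebra.Generated_Groups"
    "HOL-Number_Theory.Prime_Powers"
begin

section \<open>Coherent configurations\<close>

record 'a config =
  points :: "'a set"
  basis_rels :: "'a rel set"

definition relations :: "'a config \<Rightarrow> 'a rel set" where
  "relations X = {\<Union>R | R. R \<subseteq> basis_rels X}"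

(* The number of g with (a, g) in r and (g, b) in s. *)
definition path_count :: "'a rel \<Rightarrow> 'a rel \<Rightarrow> 'a \<Rightarrow> 'a \<Rightarrow> nat" where
  "path_count r s a b = card (r `` {a} \<inter> (s\<inverse>) `` {b})"

definition coherent_configuration :: "'a config \<Rightarrow> bool" where
  "coherent_configuration X \<longleftrightarrow>
     finite (points X) \<and>
     partition_on (points X \<times> points X) (basis_rels X) \<and>
     Id_on (points X) \<in> relations X \<and>
     (\<forall>s\<in>basis_rels X. s\<inverse> \<in> basis_rels X) \<and>
     (\<forall>r\<in>basis_rels X. \<forall>s\<in>basis_rels X. \<forall>t\<in>basis_rels X.
        \<exists>c. \<forall>(a, b)\<in>t. path_count r s a b = c)"

(* Well defined for basis relations r, s, t of a coherent configuration, since t is nonempty. *)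
definition intersection_number :: "'a rel \<Rightarrow> 'a rel \<Rightarrow> 'a rel \<Rightarrow> nat" where
  "intersection_number r s t = (THE c. \<forall>(a, b)\<in>t. path_count r s a b = c)"

definition fibers :: "'a config \<Rightarrow> 'a set set" where
  "fibers X = {D. D \<subseteq> points X \<and> Id_on D \<in> basis_rels X}"

definition config_le :: "'a config \<Rightarrow> 'a config \<Rightarrow> bool" where
  "config_le X Y \<longleftrightarrow> points X = points Y \<and> relations X \<subseteq> relations Y"

definition Inv :: "'a set \<Rightarrow> ('a \<Rightarrow> 'a) set \<Rightarrow> 'a config" where
  "Inv \<Omega> G = \<lparr>points = \<Omega>,
     basis_rels = {{(g a, g b) | g. g \<in> G} | a b. a \<in> \<Omega> \<and> b \<in> \<Omega>}\<rparr>"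


section \<open>Isomorphisms and algebraic isomorphisms\<close>

definition rel_image :: "('a \<Rightarrow> 'b) \<Rightarrow> 'a rel \<Rightarrow> 'b rel" where
  "rel_image f s = map_prod f f ` s"

definition isomorphism :: "'a config \<Rightarrow> 'b config \<Rightarrow> ('a \<Rightarrow> 'b) \<Rightarrow> bool" where
  "isomorphism X Y f \<longleftrightarrow>
     bij_betw f (points X) (points Y) \<and> rel_image f ` basis_rels X = basis_rels Y"

definition algebraic_isomorphism ::
    "'a config \<Rightarrow> 'b config \<Rightarrow> ('a rel \<Rightarrow> 'b rel) \<Rightarrow> bool" where
  "algebraic_isomorphism X Y \<phi> \<longleftrightarrow>
     bij_betw \<phi> (basis_rels X) (basis_rels Y) \<and>
     (\<forall>r\<in>basis_rels X. \<forall>s\<in>basis_rels X. \<forall>t\<in>basis_rels X.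
        intersection_number r s t = intersection_number (\<phi> r) (\<phi> s) (\<phi> t))"

(* The extension of an algebraic isomorphism to relations (unions of basis relations). *)
definition union_ext :: "'a config \<Rightarrow> ('a rel \<Rightarrow> 'b rel) \<Rightarrow> 'a rel \<Rightarrow> 'b rel" where
  "union_ext X \<phi> R = \<Union>(\<phi> ` {s \<in> basis_rels X. s \<subseteq> R})"

definition induced_by ::
    "'a config \<Rightarrow> ('a rel \<Rightarrow> 'b rel) \<Rightarrow> ('a \<Rightarrow> 'b) \<Rightarrow> bool" where
  "induced_by X \<phi> f \<longleftrightarrow> (\<forall>s\<in>basis_rels X. \<phi> s = rel_image f s)"


section \<open>Cartesian powers, extensions and the separability number\<close>

(* m-tuples are lists of length m. *)
definition tuples :: "nat \<Rightarrow> 'a set \<Rightarrow> 'a list set" where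
  "tuples m A = {xs. length xs = m \<and> set xs \<subseteq> A}"

definition diag :: "nat \<Rightarrow> 'a set \<Rightarrow> 'a list set" where
  "diag m A = {replicate m a | a. a \<in> A}"

definition tensor :: "'a rel list \<Rightarrow> 'a list rel" where
  "tensor ss = {(xs, ys). length xs = length ss \<and> length ys = length ss \<and>
     (\<forall>i<length ss. (xs ! i, ys ! i) \<in> ss ! i)}"

definition cartesian_power :: "nat \<Rightarrow> 'a config \<Rightarrow> 'a list config" where
  "cartesian_power m X =
     \<lparr>points = tuples m (points X), basis_rels = tensor ` tuples m (basis_rels X)\<rparr>"

definition extends_power :: "nat \<Rightarrow> 'a config \<Rightarrow> 'a list config \<Rightarrow> bool" where
  "extends_power m X Y \<longleftrightarrow>
     coherent_configuration Y \<and>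
     config_le (cartesian_power m X) Y \<and>
     (\<exists>F \<subseteq> fibers Y. diag m (points X) = \<Union>F)"

definition m_extension :: "nat \<Rightarrow> 'a config \<Rightarrow> 'a list config" where
  "m_extension m X =
     (THE Y. extends_power m X Y \<and> (\<forall>Z. extends_power m X Z \<longrightarrow> config_le Y Z))"

definition m_dimensional ::
    "nat \<Rightarrow> 'a config \<Rightarrow> 'b config \<Rightarrow> ('a rel \<Rightarrow> 'b rel) \<Rightarrow> bool" where
  "m_dimensional m X Y \<phi> \<longleftrightarrow>
     algebraic_isomorphism X Y \<phi> \<and>
     (\<exists>\<psi>. algebraic_isomorphism (m_extension m X) (m_extension m Y) \<psi> \<and>
        (\<forall>ss \<in> tuples m (basis_rels X).
           union_ext (m_extension m X) \<psi> (tensor ss) = tensor (map \<phi> ss)) \<and>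
        union_ext (m_extension m X) \<psi> (Id_on (diag m (points X))) = Id_on (diag m (points Y)))"

(* HOL cannot quantify over types inside a definition, so the type 'b of the points of the
   target configurations is a parameter.  An algebraic isomorphism preserves the degree, and
   every finite set is in bijection with a set of natural numbers, so for infinite 'b the value
   is the separability number in the unrestricted sense; a bound on it that is stated for an
   arbitrary 'b covers the targets of every type.  A suitable m exists: m = |points X| works,
   and m = 1 if there are no points. *)
definition separability_number :: "'b itself \<Rightarrow> 'a config \<Rightarrow> nat" where
  "separability_number (T :: 'b itself) X =
     (LEAST m. 1 \<le> m \<and>
        (\<forall>(Y :: 'b config) \<phi>. coherent_configuration Y \<and> m_dimensional m X Y \<phi> \<longrightarrow>
           (\<exists>f. isomorphism X Y f \<and> induced_by X \<phi> f)))"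


section \<open>The Passman scheme\<close>

definition monomial_matrix :: "'k::field ^ 'n ^ 'n \<Rightarrow> bool" where
  "monomial_matrix A \<longleftrightarrow> (\<forall>i. \<exists>!j. A $ i $ j \<noteq> 0) \<and> (\<forall>j. \<exists>!i. A $ i $ j \<noteq> 0)"

definition passman_group :: "('k::field ^ 2 \<Rightarrow> 'k ^ 2) set" where
  "passman_group = generate (BijGroup UNIV)
     ({\<lambda>x. x + v | v. True} \<union>
      {\<lambda>x. A *v x | A. monomial_matrix A \<and> (det A = 1 \<or> det A = - 1)})"

definition passman_scheme :: "('k::field ^ 2) config" where
  "passman_scheme = Inv UNIV passman_group"

end

theory Submission
  imports Defs "HOL-Number_Theory.Residues"
begin

text \<open>Why three dimensions suffice. The basis relation of the 3-extension between two triples is a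
  very rich invariant: it fixes the basis relations between all entries of the triples, and it
  satisfies a back-and-forth property (\<open>same_rel_back_and_forth\<close>), where each move places three
  points at once. For the Passman scheme this invariant has a rigid frame: starting from the
  corner triple \<open>x\<close> of the points \<open>0\<close>, \<open>(1, 0)\<close>, \<open>(0, 1)\<close>, no two points \<open>d\<close>, \<open>e\<close> have their
  diagonal triples in the same basis relation with \<open>x\<close> (\<open>passman_diagonal_separated\<close>). The only
  fact about the scheme that this uses, apart from equality of points, is that the product of the
  coordinate differences of two points is, up to sign, an invariant of their basis relation.

  A frame of this kind makes every coherent configuration separable in the respective dimension
  (\<open>induced_if_diagonal_separated\<close>). The algebraic isomorphism of the extensions provides an image
  of the frame, and the relations between the frame and the diagonal, being distinct, name the
  points on both sides; matching the names gives a point map, and the intersection numbers show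
  that it induces the given algebraic isomorphism.

  All of this presupposes that the extension exists. Coherent configurations on a fixed point set
  are closed under meets (\<open>coherent_meet_exists\<close>), so the smallest one that contains the Cartesian
  power and the diagonal is the meet of all of them.\<close>


section \<open>Relations of a coherent configuration\<close>

lemma basis_rel_subset:
  assumes "coherent_configuration X" "s \<in> basis_rels X"
  shows "s \<subseteq> points X \<times> points X"
  using assms by (auto simp: coherent_configuration_def partition_on_def)

lemma basis_rel_exists:
  assumes "coherent_configuration X" "a \<in> points X" "b \<in> points X"
  obtains s where "s \<in> basis_rels X" "(a, b) \<in> s"
proof -
  have "(a, b) \<in> \<Union>(basis_rels X)"
    using assms by (auto simp: coherent_configuration_def partition_on_def)
  then show ?thesis using that by blast
qed

lemma basis_rel_unique:
  assumes "coherent_configuration X" "s \<in> basis_rels X" "t \<in> basis_rels X" "p \<in> s" "p \<in> t"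
  shows "s = t"
  using assms by (auto simp: coherent_configuration_def partition_on_def disjoint_def)

lemma basis_rel_nonempty:
  assumes "coherent_configuration X" "s \<in> basis_rels X"
  obtains a b where "(a, b) \<in> s"
  using assms by (cases "s = {}") (auto simp: coherent_configuration_def partition_on_def)

lemma mem_relations_iff:
  assumes "partition_on (points X \<times> points X) (basis_rels X)"
  shows "R \<in> relations X \<longleftrightarrow> R \<subseteq> points X \<times> points X \<and>
    (\<forall>s\<in>basis_rels X. \<forall>p\<in>s. \<forall>q\<in>s. p \<in> R \<longrightarrow> q \<in> R)" (is "_ \<longleftrightarrow> ?sat")
proof
  assume "R \<in> relations X"
  then obtain B where B: "R = \<Union>B" "B \<subseteq> basis_rels X" by (auto simp: relations_def)
  have "q \<in> R" if "s \<in> basis_rels X" "p \<in> s" "q \<in> s" "p \<in> R" for s p q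
  proof -
    obtain t where t: "t \<in> B" "p \<in> t" using B(1) \<open>p \<in> R\<close> by blast
    then have "t \<in> basis_rels X" "t \<inter> s \<noteq> {}" using B that by auto
    then have "t = s"
      using assms that(1) by (meson disjointD partition_onD2)
    then show ?thesis using t that B by blast
  qed
  moreover have "R \<subseteq> points X \<times> points X"
    using B assms by (auto simp: partition_on_def)
  ultimately show ?sat by blast
next
  assume sat: ?sat
  have "R = \<Union>{s \<in> basis_rels X. s \<subseteq> R}"
  proof
    show "R \<subseteq> \<Union>{s \<in> basis_rels X. s \<subseteq> R}"
    proof
      fix p assume p: "p \<in> R"
      then have "p \<in> \<Union>(basis_rels X)" using sat assms by (auto simp: partition_on_def)
      then obtain s where s: "s \<in> basis_rels X" "p \<in> s" by blast
      then have "s \<subseteq> R" using sat p by blast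
      then show "p \<in> \<Union>{s \<in> basis_rels X. s \<subseteq> R}" using s by blast
    qed
  qed blast
  then show "R \<in> relations X" unfolding relations_def by blast
qed

lemma basis_rel_in_relations: "s \<in> basis_rels X \<Longrightarrow> s \<in> relations X"
  unfolding relations_def by (intro CollectI exI[of _ "{s}"]) auto

lemma basis_rel_subset_relation:
  assumes "coherent_configuration X" "R \<in> relations X" "s \<in> basis_rels X" "p \<in> s" "p \<in> R"
  shows "s \<subseteq> R"
  using assms mem_relations_iff[of X R] unfolding coherent_configuration_def by blast

text \<open>The basis relations are the minimal nonempty relations.\<close>

lemma config_eqI_relations:
  fixes X Y :: "'a config"
  assumes X: "coherent_configuration X" and Y: "coherent_configuration Y"
    and pts: "points X = points Y" and rels: "relations X = relations Y"
  shows "X = Y"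
proof -
  have sub: "basis_rels U \<subseteq> basis_rels V"
    if U: "coherent_configuration U" and V: "coherent_configuration V"
      and eq: "relations U = relations V" "points U = points V" for U V :: "'a config"
  proof
    fix s assume s: "s \<in> basis_rels U"
    obtain a b where ab: "(a, b) \<in> s" using basis_rel_nonempty[OF U s] .
    then have "a \<in> points V" "b \<in> points V" using basis_rel_subset[OF U s] eq by auto
    then obtain t where t: "t \<in> basis_rels V" "(a, b) \<in> t" using basis_rel_exists[OF V] by metis
    have "t \<subseteq> s"
      using basis_rel_subset_relation[OF V _ t ab] basis_rel_in_relations[OF s] eq by simp
    moreover have "s \<subseteq> t"
      using basis_rel_subset_relation[OF U _ s ab t(2)] basis_rel_in_relations[OF t(1)] eq by simp
    ultimately show "s \<in> basis_rels V" using t by simp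
  qed
  have "basis_rels X = basis_rels Y"
    using sub[OF X Y rels pts] sub[OF Y X rels[symmetric] pts[symmetric]] by blast
  with pts show ?thesis by simp
qed

lemma converse_in_relations:
  assumes "coherent_configuration X" "R \<in> relations X"
  shows "R\<inverse> \<in> relations X"
proof -
  obtain B where B: "R = \<Union>B" "B \<subseteq> basis_rels X" using assms(2) by (auto simp: relations_def)
  have "R\<inverse> = \<Union>(converse ` B)" using B by auto
  moreover have "converse ` B \<subseteq> basis_rels X"
    using assms(1) B by (auto simp: coherent_configuration_def)
  ultimately show ?thesis unfolding relations_def by blast
qed

text \<open>Path counts are additive in both relations, so the regularity condition passes from
  basis relations to arbitrary relations.\<close>

lemma path_count_relations:
  assumes X: "coherent_configuration X" and r: "r \<in> relations X" and s: "s \<in> relations X"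
    and t: "t \<in> basis_rels X" "(a, b) \<in> t" "(a', b') \<in> t"
  shows "path_count r s a b = path_count r s a' b'"
proof -
  obtain R where R: "r = \<Union>R" "R \<subseteq> basis_rels X" using r by (auto simp: relations_def)
  obtain S where S: "s = \<Union>S" "S \<subseteq> basis_rels X" using s by (auto simp: relations_def)
  have fin: "finite (points X)" using X by (simp add: coherent_configuration_def)
  have "finite (basis_rels X)"
    using X finite_elements[OF _ , of "points X \<times> points X"] by (auto simp: coherent_configuration_def)
  then have finRS: "finite (R \<times> S)" using R S by (meson finite_SigmaI finite_subset)
  have sum: "path_count r s c d = (\<Sum>(u, v)\<in>R \<times> S. path_count u v c d)" for c d
  proof -
    have eq: "r `` {c} \<inter> (s\<inverse>) `` {d} = (\<Union>x\<in>R \<times> S. fst x `` {c} \<inter> (snd x)\<inverse> `` {d})"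
      using R S by auto
    have "finite (fst x `` {c} \<inter> (snd x)\<inverse> `` {d})" if "x \<in> R \<times> S" for x
    proof (rule finite_subset[OF _ fin])
      show "fst x `` {c} \<inter> (snd x)\<inverse> `` {d} \<subseteq> points X"
        using basis_rel_subset[OF X] that R(2) by (cases x) auto
    qed
    moreover have "(fst x `` {c} \<inter> (snd x)\<inverse> `` {d}) \<inter> (fst y `` {c} \<inter> (snd y)\<inverse> `` {d}) = {}"
      if "x \<in> R \<times> S" "y \<in> R \<times> S" "x \<noteq> y" for x y
    proof (rule ccontr)
      assume "\<not> ?thesis"
      then obtain g where "(c, g) \<in> fst x" "(c, g) \<in> fst y" "(g, d) \<in> snd x" "(g, d) \<in> snd y"
        by auto
      then have "fst x = fst y" "snd x = snd y"
        using that R S basis_rel_unique[OF X] by (metis mem_Times_iff subsetD)+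
      then show False using that(3) by (simp add: prod_eq_iff)
    qed
    ultimately have "card (\<Union>x\<in>R \<times> S. fst x `` {c} \<inter> (snd x)\<inverse> `` {d}) =
        (\<Sum>x\<in>R \<times> S. card (fst x `` {c} \<inter> (snd x)\<inverse> `` {d}))"
      using finRS by (intro card_UN_disjoint) auto
    then show ?thesis unfolding path_count_def eq by (simp add: case_prod_beta)
  qed
  have "path_count u v a b = path_count u v a' b'" if "u \<in> R" "v \<in> S" for u v
  proof -
    have "\<exists>k. \<forall>(a, b)\<in>t. path_count u v a b = k"
      using X that R S t(1) unfolding coherent_configuration_def by blast
    then obtain k where k: "\<forall>(a, b)\<in>t. path_count u v a b = k" ..
    have "path_count u v a b = k" "path_count u v a' b' = k"
      using bspec[OF k t(2)] bspec[OF k t(3)] by simp_all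
    then show ?thesis by simp
  qed
  then show ?thesis unfolding sum by (intro sum.cong) auto
qed

lemma intersection_number_eq:
  assumes X: "coherent_configuration X"
    and "r \<in> basis_rels X" "s \<in> basis_rels X" "t \<in> basis_rels X" "(a, b) \<in> t"
  shows "intersection_number r s t = path_count r s a b"
  unfolding intersection_number_def
proof (rule the_equality)
  show "\<forall>(a', b')\<in>t. path_count r s a' b' = path_count r s a b"
    using path_count_relations[OF X _ _ assms(4) _ assms(5)] assms basis_rel_in_relations by blast
next
  fix c assume "\<forall>(a, b)\<in>t. path_count r s a b = c"
  then show "c = path_count r s a b" using assms(5) by auto
qed

lemma path_count_pos_iff:
  assumes X: "coherent_configuration X" and "r \<in> basis_rels X"
  shows "path_count r s a b > 0 \<longleftrightarrow> (\<exists>c. (a, c) \<in> r \<and> (c, b) \<in> s)"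
proof -
  have "r `` {a} \<inter> s\<inverse> `` {b} \<subseteq> points X" using basis_rel_subset[OF assms] by auto
  then have "finite (r `` {a} \<inter> s\<inverse> `` {b})"
    using X finite_subset by (auto simp: coherent_configuration_def)
  then show ?thesis unfolding path_count_def card_gt_0_iff by auto
qed


section \<open>The smallest coherent configuration with prescribed relations\<close>

text \<open>Coherent configurations on a fixed point set are closed under meets. The basis relations of
  the meet are the classes of pairs which no common relation can tell apart. The path counts of
  two of these classes are constant on the basis relations of every given configuration, so their
  level sets are again common relations; this is the regularity condition.\<close>

lemma coherent_meet_exists:
  fixes C :: "'a config set"
  assumes ne: "C \<noteq> {}" and coh: "\<And>Z. Z \<in> C \<Longrightarrow> coherent_configuration Z"
    and pts: "\<And>Z. Z \<in> C \<Longrightarrow> points Z = V"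
  obtains M where "coherent_configuration M" "points M = V"
    "relations M = (\<Inter>Z\<in>C. relations Z)"
proof -
  define A where "A = (\<Inter>Z\<in>C. relations Z)"
  define E where "E = {(p, q). p \<in> V \<times> V \<and> q \<in> V \<times> V \<and> (\<forall>R\<in>A. p \<in> R \<longleftrightarrow> q \<in> R)}"
  define M where "M = \<lparr>points = V, basis_rels = (V \<times> V) // E\<rparr>"
  have M_simps [simp]: "points M = V" "basis_rels M = (V \<times> V) // E" by (simp_all add: M_def)
  have equiv: "equiv (V \<times> V) E"
    by (rule equivI) (auto simp: E_def refl_on_def sym_def trans_def)
  then have part: "partition_on (points M \<times> points M) (basis_rels M)"
    using partition_on_quotient by simp
  have partZ: "partition_on (points Z \<times> points Z) (basis_rels Z)" if "Z \<in> C" for Z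
    using coh[OF that] by (simp add: coherent_configuration_def)
  have rel_Z: "R \<in> relations Z \<longleftrightarrow> R \<subseteq> V \<times> V \<and> (\<forall>s\<in>basis_rels Z. \<forall>p\<in>s. \<forall>q\<in>s. p \<in> R \<longrightarrow> q \<in> R)"
    if "Z \<in> C" for Z R
    using mem_relations_iff[OF partZ[OF that]] pts[OF that] by simp
  have AE: "(p, q) \<in> E" if "Z \<in> C" "s \<in> basis_rels Z" "p \<in> s" "q \<in> s" for Z s p q
  proof -
    have "p \<in> V \<times> V" "q \<in> V \<times> V"
      using basis_rel_subset[OF coh[OF that(1)] that(2)] that pts by auto
    moreover have "p \<in> R \<longleftrightarrow> q \<in> R" if "R \<in> A" for R
    proof -
      have "R \<in> relations Z" using \<open>R \<in> A\<close> \<open>Z \<in> C\<close> by (auto simp: A_def)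
      then show ?thesis using rel_Z[OF \<open>Z \<in> C\<close>] \<open>s \<in> basis_rels Z\<close> \<open>p \<in> s\<close> \<open>q \<in> s\<close> by blast
    qed
    ultimately show ?thesis by (simp add: E_def)
  qed
  have class_E: "(p, q) \<in> E" if "s \<in> basis_rels M" "p \<in> s" "q \<in> s" for s p q
    using that quotient_eq_iff[OF equiv, of s s p q] by simp
  have sat_M: "R \<in> relations M \<longleftrightarrow> R \<subseteq> V \<times> V \<and>
      (\<forall>s\<in>basis_rels M. \<forall>p\<in>s. \<forall>q\<in>s. p \<in> R \<longrightarrow> q \<in> R)" for R
    using mem_relations_iff[OF part] by simp
  have rel_M: "relations M = A"
  proof
    show "A \<subseteq> relations M"
    proof
      fix R assume R: "R \<in> A"
      obtain Z where "Z \<in> C" using ne by blast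
      then have "R \<subseteq> V \<times> V" using rel_Z R by (auto simp: A_def)
      moreover have "q \<in> R" if "s \<in> basis_rels M" "p \<in> s" "q \<in> s" "p \<in> R" for s p q
        using class_E[OF that(1-3)] that(4) R by (auto simp: E_def)
      ultimately show "R \<in> relations M" unfolding sat_M by blast
    qed
    show "relations M \<subseteq> A"
    proof
      fix R assume "R \<in> relations M"
      then have sub: "R \<subseteq> V \<times> V"
        and sat: "\<And>s p q. s \<in> basis_rels M \<Longrightarrow> p \<in> s \<Longrightarrow> q \<in> s \<Longrightarrow> p \<in> R \<Longrightarrow> q \<in> R"
        unfolding sat_M by blast+
      have "R \<in> relations Z" if Z: "Z \<in> C" for Z
      proof -
        have "q \<in> R" if s: "s \<in> basis_rels Z" "p \<in> s" "q \<in> s" "p \<in> R" for s p q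
        proof -
          have pq: "(p, q) \<in> E" using AE[OF Z s(1-3)] .
          then have "p \<in> V \<times> V" by (auto simp: E_def)
          then have "E `` {p} \<in> basis_rels M" by (simp add: quotientI)
          moreover have "p \<in> E `` {p}" "q \<in> E `` {p}"
            using pq \<open>p \<in> V \<times> V\<close> equiv_class_self[OF equiv] by blast+
          ultimately show "q \<in> R" using sat \<open>p \<in> R\<close> by blast
        qed
        then show ?thesis using sub rel_Z[OF Z] by blast
      qed
      then show "R \<in> A" by (simp add: A_def)
    qed
  qed
  have "Id_on V \<in> relations M"
    using coh pts unfolding rel_M by (force simp: A_def coherent_configuration_def)
  moreover have "finite V" using ne coh pts by (auto simp: coherent_configuration_def)
  moreover have "s\<inverse> \<in> basis_rels M" if s: "s \<in> basis_rels M" for s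
  proof -
    obtain a b where ab: "a \<in> V" "b \<in> V" "s = E `` {(a, b)}"
      using s by (auto simp: quotient_def)
    have conv: "R\<inverse> \<in> A" if "R \<in> A" for R
      using that coh converse_in_relations by (auto simp: A_def)
    have E_conv: "((d, c), (d', c')) \<in> E" if "((c, d), (c', d')) \<in> E" for c d c' d'
    proof -
      have "(d, c) \<in> R \<longleftrightarrow> (d', c') \<in> R" if "R \<in> A" for R
        using \<open>((c, d), (c', d')) \<in> E\<close> conv[OF that] by (auto simp: E_def)
      then show ?thesis using that by (auto simp: E_def)
    qed
    have "s\<inverse> = E `` {(b, a)}" unfolding ab(3) using E_conv by auto
    then show ?thesis using ab by (auto intro: quotientI)
  qed
  moreover have "\<exists>c. \<forall>(a, b)\<in>t. path_count r s a b = c"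
    if r: "r \<in> basis_rels M" and s: "s \<in> basis_rels M" and t: "t \<in> basis_rels M" for r s t
  proof -
    have rs: "r \<in> relations Z" "s \<in> relations Z" if "Z \<in> C" for Z
      using basis_rel_in_relations[OF r] basis_rel_in_relations[OF s] that unfolding rel_M
      by (auto simp: A_def)
    define L where "L c = {q \<in> V \<times> V. path_count r s (fst q) (snd q) = c}" for c
    have level: "L c \<in> A" for c
    proof -
      have "L c \<in> relations Z" if Z: "Z \<in> C" for Z
      proof -
        have "q \<in> L c" if "u \<in> basis_rels Z" "p \<in> u" "q \<in> u" "p \<in> L c" for u p q
        proof -
          have "path_count r s (fst p) (snd p) = path_count r s (fst q) (snd q)"
            using path_count_relations[OF coh[OF Z] rs[OF Z] that(1)] that(2,3) by simp
          moreover have "q \<in> V \<times> V"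
            using basis_rel_subset[OF coh[OF Z] that(1)] that(3) pts[OF Z] by blast
          ultimately show ?thesis using that(4) by (simp add: L_def)
        qed
        moreover have "L c \<subseteq> V \<times> V" by (auto simp: L_def)
        ultimately show ?thesis unfolding rel_Z[OF Z] by blast
      qed
      then show ?thesis by (simp add: A_def)
    qed
    obtain a b where ab: "(a, b) \<in> V \<times> V" "t = E `` {(a, b)}"
      using t by (auto simp: quotient_def)
    then have ab_t: "(a, b) \<in> t" using equiv_class_self[OF equiv] by blast
    have "path_count r s a' b' = path_count r s a b" if "(a', b') \<in> t" for a' b'
    proof -
      have "((a, b), (a', b')) \<in> E" using class_E[OF t ab_t that] .
      moreover have "(a, b) \<in> L (path_count r s a b)" using ab(1) by (simp add: L_def)
      ultimately have "(a', b') \<in> L (path_count r s a b)"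
        using level unfolding E_def by blast
      then show ?thesis by (simp add: L_def)
    qed
    then show ?thesis by blast
  qed
  ultimately have "coherent_configuration M"
    using part unfolding coherent_configuration_def M_simps(1) by blast
  then show ?thesis using that rel_M by (simp add: A_def)
qed

text \<open>In this form the condition on the diagonal is inherited by meets, like the condition that the
  Cartesian power is contained in the configuration.\<close>

lemma diag_union_of_fibers_iff:
  assumes "coherent_configuration Y" "D \<subseteq> points Y"
  shows "(\<exists>F \<subseteq> fibers Y. D = \<Union>F) \<longleftrightarrow> Id_on D \<in> relations Y"
proof
  assume "\<exists>F \<subseteq> fibers Y. D = \<Union>F"
  then obtain F where F: "F \<subseteq> fibers Y" "D = \<Union>F" by blast
  have "Id_on D = \<Union>(Id_on ` F)" using F(2) by auto
  moreover have "Id_on ` F \<subseteq> basis_rels Y" using F(1) by (auto simp: fibers_def)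
  ultimately show "Id_on D \<in> relations Y" unfolding relations_def by blast
next
  assume "Id_on D \<in> relations Y"
  then obtain R where R: "Id_on D = \<Union>R" "R \<subseteq> basis_rels Y" by (auto simp: relations_def)
  have dom: "Id_on (Domain r) = r" if "r \<in> R" for r
  proof -
    have "r \<subseteq> Id_on D" using R that by blast
    then show ?thesis by auto
  qed
  have "D = \<Union>(Domain ` R)"
  proof -
    have "D = Domain (Id_on D)" by auto
    also have "\<dots> = \<Union>(Domain ` R)" unfolding R(1) by auto
    finally show ?thesis .
  qed
  moreover have "Domain ` R \<subseteq> fibers Y"
  proof
    fix E assume "E \<in> Domain ` R"
    then obtain r where r: "r \<in> R" "E = Domain r" by blast
    have "E \<subseteq> points Y" using r R(2) basis_rel_subset[OF assms(1), of r] by auto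
    moreover have "Id_on E \<in> basis_rels Y" using dom[OF r(1)] r R(2) by auto
    ultimately show "E \<in> fibers Y" by (simp add: fibers_def)
  qed
  ultimately show "\<exists>F \<subseteq> fibers Y. D = \<Union>F" by blast
qed

lemma diag_subset_tuples: "diag m A \<subseteq> tuples m A"
  by (auto simp: diag_def tuples_def)

lemma finite_tuples: "finite A \<Longrightarrow> finite (tuples m A)"
  unfolding tuples_def using finite_lists_length_eq[of A m] by (simp add: conj_commute)

lemma extends_power_iff:
  "extends_power m X Y \<longleftrightarrow> coherent_configuration Y \<and> points Y = tuples m (points X) \<and>
     relations (cartesian_power m X) \<subseteq> relations Y \<and> Id_on (diag m (points X)) \<in> relations Y"
  using diag_union_of_fibers_iff[of Y "diag m (points X)"] diag_subset_tuples[of m "points X"]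
  by (auto simp: extends_power_def config_le_def cartesian_power_def)

definition discrete_config :: "'a set \<Rightarrow> 'a config" where
  "discrete_config V = \<lparr>points = V, basis_rels = (\<lambda>p. {p}) ` (V \<times> V)\<rparr>"

lemma relations_discrete: "relations (discrete_config V) = Pow (V \<times> V)"
  using mem_relations_iff[of "discrete_config V"] partition_on_singletons[of "V \<times> V"]
  by (auto simp: discrete_config_def)

lemma coherent_discrete:
  assumes "finite V"
  shows "coherent_configuration (discrete_config V)"
proof -
  have "Id_on V \<in> relations (discrete_config V)" by (auto simp: relations_discrete)
  then show ?thesis
    using assms partition_on_singletons[of "V \<times> V"]
    by (auto simp: coherent_configuration_def discrete_config_def)
qed

text \<open>The discrete configuration meets all requirements, so the meet is taken over a nonempty family.
  The definite description then denotes this meet because the order is antisymmetric.\<close>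

lemma extends_power_m_extension:
  fixes X :: "'a config"
  assumes fin: "finite (points X)" and sub: "\<And>s. s \<in> basis_rels X \<Longrightarrow> s \<subseteq> points X \<times> points X"
  shows "extends_power m X (m_extension m X)"
proof -
  let ?C = "{Z. extends_power m X Z}"
  let ?V = "tuples m (points X)"
  have "r \<subseteq> ?V \<times> ?V" if r: "r \<in> relations (cartesian_power m X)" for r
  proof -
    have "(xs, ys) \<in> ?V \<times> ?V" if "ss \<in> tuples m (basis_rels X)" "(xs, ys) \<in> tensor ss" for xs ys ss
    proof -
      have "length ss = m" "length xs = m" "length ys = m"
        using that by (auto simp: tensor_def tuples_def)
      moreover have "xs ! i \<in> points X \<and> ys ! i \<in> points X" if "i < m" for i
      proof -
        have "ss ! i \<in> basis_rels X" "(xs ! i, ys ! i) \<in> ss ! i"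
          using \<open>ss \<in> _\<close> \<open>_ \<in> tensor ss\<close> that \<open>length ss = m\<close> by (auto simp: tuples_def tensor_def)
        then show ?thesis using sub by blast
      qed
      ultimately show ?thesis by (auto simp: tuples_def set_conv_nth)
    qed
    then show ?thesis using r by (auto simp: relations_def cartesian_power_def)
  qed
  moreover have "Id_on (diag m (points X)) \<subseteq> ?V \<times> ?V" using diag_subset_tuples[of m "points X"] by auto
  ultimately have "extends_power m X (discrete_config ?V)"
    using coherent_discrete[OF finite_tuples[OF fin, of m]]
    unfolding extends_power_iff relations_discrete by (auto simp: discrete_config_def)
  then have ne: "?C \<noteq> {}" by blast
  obtain M where M: "coherent_configuration M" "points M = ?V" "relations M = (\<Inter>Z\<in>?C. relations Z)"
  proof (rule coherent_meet_exists[OF ne, of ?V])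
    show "coherent_configuration Z" "points Z = ?V" if "Z \<in> ?C" for Z
      using that by (simp_all add: extends_power_iff)
  qed (use that in blast)
  have ext: "extends_power m X M"
    using M(1,2) unfolding extends_power_iff M(3) by blast
  have least: "config_le M Z" if "extends_power m X Z" for Z
    using that M(2,3) by (auto simp: config_le_def extends_power_iff)
  have uniq: "Y = M" if Y: "extends_power m X Y" "\<forall>Z. extends_power m X Z \<longrightarrow> config_le Y Z" for Y
    using Y ext least[OF Y(1)] by (intro config_eqI_relations) (auto simp: extends_power_iff config_le_def)
  have "m_extension m X = M"
    unfolding m_extension_def by (rule the_equality) (use ext least uniq in blast)+
  then show ?thesis using ext by simp
qed


section \<open>Algebraic isomorphisms transport paths\<close>

lemma algebraic_isomorphism_path:
  assumes X: "coherent_configuration X" and Y: "coherent_configuration Y"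
    and iso: "algebraic_isomorphism X Y \<psi>"
    and rst: "r \<in> basis_rels X" "s \<in> basis_rels X" "t \<in> basis_rels X"
    and "(a, b) \<in> t" "(a', b') \<in> \<psi> t"
  shows "(\<exists>c. (a, c) \<in> r \<and> (c, b) \<in> s) \<longleftrightarrow> (\<exists>c. (a', c) \<in> \<psi> r \<and> (c, b') \<in> \<psi> s)"
proof -
  have im: "\<psi> r \<in> basis_rels Y" "\<psi> s \<in> basis_rels Y" "\<psi> t \<in> basis_rels Y"
    using iso rst by (auto simp: algebraic_isomorphism_def bij_betw_def)
  have "path_count r s a b = path_count (\<psi> r) (\<psi> s) a' b'"
    using iso rst intersection_number_eq[OF X rst assms(7)] intersection_number_eq[OF Y im assms(8)]
    by (simp add: algebraic_isomorphism_def)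
  then show ?thesis
    using path_count_pos_iff[OF X rst(1), of s a b] path_count_pos_iff[OF Y im(1), of "\<psi> s" a' b'] by simp
qed

lemma loop_basis_rel_subset_Id:
  assumes X: "coherent_configuration X" and "r \<in> basis_rels X" "(a, a) \<in> r"
  shows "r \<subseteq> Id_on (points X)"
proof (rule basis_rel_subset_relation[OF X _ assms(2,3)])
  show "Id_on (points X) \<in> relations X" using X by (simp add: coherent_configuration_def)
  show "(a, a) \<in> Id_on (points X)" using basis_rel_subset[OF assms(1,2)] assms(3) by auto
qed

text \<open>The loop at the source of an arrow of \<open>\<psi> r\<close> lies in a basis relation that can be composed
  with \<open>\<psi> r\<close> to give \<open>\<psi> r\<close> again. Its preimage has the same property with \<open>r\<close>, and since all
  arrows of \<open>r\<close> are loops, this preimage is \<open>r\<close> itself.\<close>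

lemma algebraic_isomorphism_loops:
  assumes X: "coherent_configuration X" and Y: "coherent_configuration Y"
    and iso: "algebraic_isomorphism X Y \<psi>"
    and r: "r \<in> basis_rels X" "(a, a) \<in> r"
  shows "\<psi> r \<subseteq> Id_on (points Y)"
proof -
  have bij: "bij_betw \<psi> (basis_rels X) (basis_rels Y)"
    using iso by (simp add: algebraic_isomorphism_def)
  have im: "\<psi> r \<in> basis_rels Y" using bij r by (auto simp: bij_betw_def)
  obtain p q where pq: "(p, q) \<in> \<psi> r" using basis_rel_nonempty[OF Y im] .
  then have "p \<in> points Y" using basis_rel_subset[OF Y im] by auto
  then obtain d' where d': "d' \<in> basis_rels Y" "(p, p) \<in> d'" using basis_rel_exists[OF Y] by metis
  obtain d where d: "d \<in> basis_rels X" "d' = \<psi> d" using bij d' by (auto simp: bij_betw_def)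
  have "\<exists>c. (a, c) \<in> d \<and> (c, a) \<in> r"
    using algebraic_isomorphism_path[OF X Y iso d(1) r(1) r(1) r(2) pq] d d' pq by blast
  then obtain c where c: "(a, c) \<in> d" "(c, a) \<in> r" by blast
  then have "(a, a) \<in> d" using loop_basis_rel_subset_Id[OF X r] by auto
  then have "d = r" using basis_rel_unique[OF X d(1) r(1) _ r(2)] by blast
  then show ?thesis using loop_basis_rel_subset_Id[OF Y d'] d by simp
qed

definition same_rel :: "'a config \<Rightarrow> 'a \<times> 'a \<Rightarrow> 'a \<times> 'a \<Rightarrow> bool" where
  "same_rel X p q \<longleftrightarrow> (\<exists>s\<in>basis_rels X. p \<in> s \<and> q \<in> s)"

text \<open>Applied to the identity, transport of paths becomes the move of a pebble game: every point
  chosen on one side has an answer on the other side.\<close>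

lemma same_rel_back_and_forth:
  assumes X: "coherent_configuration X" and same: "same_rel X (a, b) (a', b')" and c: "c \<in> points X"
  obtains c' where "same_rel X (a, c) (a', c')" "same_rel X (c, b) (c', b')"
proof -
  obtain t where t: "t \<in> basis_rels X" "(a, b) \<in> t" "(a', b') \<in> t"
    using same by (auto simp: same_rel_def)
  then have "a \<in> points X" "b \<in> points X" using basis_rel_subset[OF X] by auto
  then obtain r s where rs: "r \<in> basis_rels X" "(a, c) \<in> r" "s \<in> basis_rels X" "(c, b) \<in> s"
    using basis_rel_exists[OF X _ c] basis_rel_exists[OF X c] by metis
  have "algebraic_isomorphism X X id" by (simp add: algebraic_isomorphism_def)
  from algebraic_isomorphism_path[OF X X this rs(1,3) t(1,2)] t(3) rs
  obtain c' where "(a', c') \<in> r" "(c', b') \<in> s" by auto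
  then show ?thesis using that rs unfolding same_rel_def by blast
qed

lemma same_rel_eq_iff:
  assumes X: "coherent_configuration X" and same: "same_rel X (a, b) (a', b')"
  shows "a = b \<longleftrightarrow> a' = b'"
proof -
  obtain t where t: "t \<in> basis_rels X" "(a, b) \<in> t" "(a', b') \<in> t"
    using same by (auto simp: same_rel_def)
  show ?thesis
    using loop_basis_rel_subset_Id[OF X t(1), of a] loop_basis_rel_subset_Id[OF X t(1), of a'] t by auto
qed

lemma same_rel_right:
  assumes X: "coherent_configuration X" and same: "same_rel X (a, b) (a', b')"
  shows "same_rel X (b, b) (b', b')"
proof -
  have "b \<in> points X" using same basis_rel_subset[OF X] by (auto simp: same_rel_def)
  then obtain c' where c: "same_rel X (a, b) (a', c')" "same_rel X (b, b) (c', b')"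
    using same_rel_back_and_forth[OF X same] by metis
  then have "c' = b'" using same_rel_eq_iff[OF X c(2)] by simp
  then show ?thesis using c by simp
qed


section \<open>Coordinates in an extension\<close>

lemma basis_rel_subset_tensor:
  assumes ext: "extends_power m X Z" and ss: "ss \<in> tuples m (basis_rels X)"
    and "s \<in> basis_rels Z" "p \<in> s" "p \<in> tensor ss"
  shows "s \<subseteq> tensor ss"
proof -
  have "tensor ss \<in> relations (cartesian_power m X)"
    using ss by (intro basis_rel_in_relations) (simp add: cartesian_power_def)
  then show ?thesis
    using ext assms(3-5) by (meson basis_rel_subset_relation extends_power_iff subsetD)
qed

lemma same_rel_coordinate:
  assumes ext: "extends_power m X Z"
    and cover: "\<And>a b. a \<in> points X \<Longrightarrow> b \<in> points X \<Longrightarrow> \<exists>s\<in>basis_rels X. (a, b) \<in> s"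
    and same: "same_rel Z (x, y) (x', y')" and i: "i < m"
  shows "same_rel X (x ! i, y ! i) (x' ! i, y' ! i)"
proof -
  have Z: "coherent_configuration Z" "points Z = tuples m (points X)"
    using ext by (simp_all add: extends_power_iff)
  obtain t where t: "t \<in> basis_rels Z" "(x, y) \<in> t" "(x', y') \<in> t"
    using same by (auto simp: same_rel_def)
  have xy: "x \<in> tuples m (points X)" "y \<in> tuples m (points X)"
    using basis_rel_subset[OF Z(1) t(1)] t(2) Z(2) by auto
  have "\<exists>s\<in>basis_rels X. (x ! j, y ! j) \<in> s" if "j < m" for j
  proof (rule cover)
    show "x ! j \<in> points X" "y ! j \<in> points X" using xy that by (auto simp: tuples_def)
  qed
  then obtain S where S: "\<And>j. j < m \<Longrightarrow> S j \<in> basis_rels X \<and> (x ! j, y ! j) \<in> S j" by metis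
  define ss where "ss = map S [0..<m]"
  have "ss \<in> tuples m (basis_rels X)" "(x, y) \<in> tensor ss"
    using S xy by (auto simp: ss_def tuples_def tensor_def)
  then have "(x', y') \<in> tensor ss" using basis_rel_subset_tensor[OF ext _ t(1,2)] t(3) by blast
  then have "(x' ! i, y' ! i) \<in> S i" using i by (auto simp: tensor_def ss_def)
  then show ?thesis using S[OF i] by (auto simp: same_rel_def)
qed

lemma same_rel_diag:
  assumes ext: "extends_power m X Z" and same: "same_rel Z (x, y) (x', y')"
    and y: "y \<in> diag m (points X)"
  shows "y' \<in> diag m (points X)"
proof -
  have Z: "coherent_configuration Z" "Id_on (diag m (points X)) \<in> relations Z"
    using ext by (simp_all add: extends_power_iff)
  have "same_rel Z (y, y) (y', y')" using same_rel_right[OF Z(1) same] .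
  then obtain s where s: "s \<in> basis_rels Z" "(y, y) \<in> s" "(y', y') \<in> s" by (auto simp: same_rel_def)
  then have "s \<subseteq> Id_on (diag m (points X))"
    using basis_rel_subset_relation[OF Z s(1,2)] y by blast
  then show ?thesis using s by blast
qed

text \<open>Distinct coordinates can be compared as well: the diagonal tuple with entry \<open>x ! i\<close>
  carries the \<open>i\<close>-th coordinate of \<open>x\<close> to every other place.\<close>

lemma same_rel_coordinates:
  assumes ext: "extends_power m X Z"
    and cover: "\<And>a b. a \<in> points X \<Longrightarrow> b \<in> points X \<Longrightarrow> \<exists>s\<in>basis_rels X. (a, b) \<in> s"
    and eq: "\<And>a b a' b'. same_rel X (a, b) (a', b') \<Longrightarrow> a = b \<Longrightarrow> a' = b'"
    and same: "same_rel Z (x, y) (x', y')" and ij: "i < m" "j < m"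
  shows "same_rel X (x ! i, y ! j) (x' ! i, y' ! j)"
proof -
  have Z: "coherent_configuration Z" "points Z = tuples m (points X)"
    using ext by (simp_all add: extends_power_iff)
  have "x \<in> tuples m (points X)"
    using same basis_rel_subset[OF Z(1)] Z(2) by (auto simp: same_rel_def)
  then have "x ! i \<in> points X" using ij by (auto simp: tuples_def)
  then have z: "replicate m (x ! i) \<in> diag m (points X)" (is "?z \<in> _") by (auto simp: diag_def)
  obtain z' where z': "same_rel Z (x, ?z) (x', z')" "same_rel Z (?z, y) (z', y')"
    using same_rel_back_and_forth[OF Z(1) same] z diag_subset_tuples Z(2) by (metis subsetD)
  obtain c where c: "z' = replicate m c" using same_rel_diag[OF ext z'(1) z] by (auto simp: diag_def)
  have "x' ! i = c"
    using eq[OF same_rel_coordinate[OF ext cover z'(1) ij(1)]] ij c by simp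
  then show ?thesis
    using same_rel_coordinate[OF ext cover z'(2) ij(2)] ij c by simp
qed


section \<open>Separating the diagonal by one point of the extension\<close>

text \<open>If the basis relations leaving one tuple \<open>x\<close> separate the diagonal tuples, then an algebraic
  isomorphism of the extensions leaves no choice for a point map: fix an image \<open>x'\<close> of \<open>x\<close> and
  send \<open>a\<close> to the entry of the only diagonal tuple which is reached from \<open>x'\<close> by the image of the
  relation from \<open>x\<close> to \<open>(a, \<dots>, a)\<close>. Transport of paths through two diagonal tuples shows that
  this map induces the given algebraic isomorphism.\<close>

lemma induced_if_diagonal_separated:
  fixes X :: "'a config" and Y :: "'b config"
  assumes m: "0 < m"
    and finX: "finite (points X)"
    and subX: "\<And>s. s \<in> basis_rels X \<Longrightarrow> s \<subseteq> points X \<times> points X"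
    and coverX: "\<And>a b. a \<in> points X \<Longrightarrow> b \<in> points X \<Longrightarrow> \<exists>s\<in>basis_rels X. (a, b) \<in> s"
    and x: "x \<in> tuples m (points X)"
    and sep: "\<And>a b. same_rel (m_extension m X) (x, replicate m a) (x, replicate m b) \<Longrightarrow> a = b"
    and Y: "coherent_configuration Y" and dim: "m_dimensional m X Y \<phi>"
  obtains f where "isomorphism X Y f" "induced_by X \<phi> f"
proof -
  define Xh where "Xh = m_extension m X"
  define Yh where "Yh = m_extension m Y"
  have extX: "extends_power m X Xh"
    unfolding Xh_def using finX subX by (rule extends_power_m_extension)
  have extY: "extends_power m Y Yh"
    unfolding Yh_def
    using Y basis_rel_subset[OF Y] by (intro extends_power_m_extension) (auto simp: coherent_configuration_def)
  have Xh: "coherent_configuration Xh" "points Xh = tuples m (points X)"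
    and Yh: "coherent_configuration Yh" "points Yh = tuples m (points Y)"
    using extX extY by (simp_all add: extends_power_iff)
  have phi: "bij_betw \<phi> (basis_rels X) (basis_rels Y)"
    using dim by (simp add: m_dimensional_def algebraic_isomorphism_def)
  have "\<exists>\<psi>. algebraic_isomorphism Xh Yh \<psi> \<and>
      (\<forall>ss\<in>tuples m (basis_rels X). union_ext Xh \<psi> (tensor ss) = tensor (map \<phi> ss)) \<and>
      union_ext Xh \<psi> (Id_on (diag m (points X))) = Id_on (diag m (points Y))"
    using dim by (simp only: m_dimensional_def Xh_def Yh_def)
  then obtain \<psi> where iso: "algebraic_isomorphism Xh Yh \<psi>"
    and tens: "\<And>ss. ss \<in> tuples m (basis_rels X) \<Longrightarrow> union_ext Xh \<psi> (tensor ss) = tensor (map \<phi> ss)"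
    and dg: "union_ext Xh \<psi> (Id_on (diag m (points X))) = Id_on (diag m (points Y))"
    by metis
  have psi: "bij_betw \<psi> (basis_rels Xh) (basis_rels Yh)"
    using iso by (simp add: algebraic_isomorphism_def)
  note path = algebraic_isomorphism_path[OF Xh(1) Yh(1) iso]
  let ?D = "\<lambda>a. replicate m a"
  have D_in: "?D a \<in> points Xh" if "a \<in> points X" for a
    using that diag_subset_tuples[of m "points X"] Xh(2) by (auto simp: diag_def)

  \<comment> \<open>an image \<open>x'\<close> of \<open>x\<close>\<close>
  obtain e where e: "e \<in> basis_rels Xh" "(x, x) \<in> e" using basis_rel_exists[OF Xh(1)] x Xh(2) by metis
  have "\<psi> e \<in> basis_rels Yh" using psi e by (auto simp: bij_betw_def)
  then obtain x' y' where "(x', y') \<in> \<psi> e" using basis_rel_nonempty[OF Yh(1)] by metis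
  then have x': "(x', x') \<in> \<psi> e" using algebraic_isomorphism_loops[OF Xh(1) Yh(1) iso e] by auto
  have x'_in: "x' \<in> points Yh" using x' basis_rel_subset[OF Yh(1) \<open>\<psi> e \<in> _\<close>] by auto

  have psi_diag: "\<psi> d \<subseteq> Id_on (diag m (points Y))"
    if "d \<in> basis_rels Xh" "d \<subseteq> Id_on (diag m (points X))" for d
    using that dg by (auto simp: union_ext_def)

  \<comment> \<open>the relation from \<open>x\<close> to the diagonal tuple of \<open>a\<close>\<close>
  have "\<forall>a. \<exists>t. a \<in> points X \<longrightarrow> t \<in> basis_rels Xh \<and> (x, ?D a) \<in> t"
    using basis_rel_exists[OF Xh(1)] x Xh(2) D_in by metis
  then obtain T where T: "\<And>a. a \<in> points X \<Longrightarrow> T a \<in> basis_rels Xh"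
      "\<And>a. a \<in> points X \<Longrightarrow> (x, ?D a) \<in> T a"
    by metis
  have T_inj: "a = b" if "a \<in> points X" "b \<in> points X" "T a = T b" for a b
    using sep[of a b] T[OF that(1)] T[OF that(2)] that(3) by (auto simp: same_rel_def Xh_def)
  have T_unique: "z = ?D a" if a: "a \<in> points X" and z: "(x, z) \<in> T a" for a z
  proof -
    have same: "same_rel Xh (x, ?D a) (x, z)" using T[OF a] z by (auto simp: same_rel_def)
    then obtain b where "z = ?D b"
      using same_rel_diag[OF extX same] a by (auto simp: diag_def)
    then show ?thesis using sep[of a b] same by (simp add: Xh_def)
  qed
  have psiT_in: "\<psi> (T a) \<in> basis_rels Yh" if "a \<in> points X" for a
    using psi T(1)[OF that] by (auto simp: bij_betw_def)
  have psiT_unique: "z = w" if a: "a \<in> points X" and z: "(x', z) \<in> \<psi> (T a)" and w: "(x', w) \<in> \<psi> (T a)" for a z w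
  proof -
    have "z \<in> points Yh" "w \<in> points Yh" using z w basis_rel_subset[OF Yh(1) psiT_in[OF a]] by auto
    then obtain r' where r': "r' \<in> basis_rels Yh" "(z, w) \<in> r'" using basis_rel_exists[OF Yh(1)] by metis
    obtain r where r: "r \<in> basis_rels Xh" "r' = \<psi> r" using psi r' by (auto simp: bij_betw_def)
    have "\<exists>c. (x, c) \<in> T a \<and> (c, ?D a) \<in> r"
      using path[OF T(1)[OF a] r(1) T(1)[OF a] T(2)[OF a] w] z r' r by blast
    then have "(?D a, ?D a) \<in> r" using T_unique[OF a] by blast
    then show ?thesis using algebraic_isomorphism_loops[OF Xh(1) Yh(1) iso r(1)] r r' by auto
  qed
  have psiT_diag: "z \<in> diag m (points Y)" if a: "a \<in> points X" and z: "(x', z) \<in> \<psi> (T a)" for a z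
  proof -
    obtain d where d: "d \<in> basis_rels Xh" "(?D a, ?D a) \<in> d"
      using basis_rel_exists[OF Xh(1)] D_in[OF a] by metis
    have "d \<subseteq> Id_on (diag m (points X))"
      using basis_rel_subset_relation[OF Xh(1) _ d] extX a by (auto simp: extends_power_iff diag_def)
    then have "\<psi> d \<subseteq> Id_on (diag m (points Y))" by (rule psi_diag[OF d(1)])
    moreover have "\<exists>c. (x', c) \<in> \<psi> (T a) \<and> (c, z) \<in> \<psi> d"
      using path[OF T(1)[OF a] d(1) T(1)[OF a] T(2)[OF a] z] d T(2)[OF a] by blast
    ultimately show ?thesis by blast
  qed
  have "\<exists>b. b \<in> points Y \<and> (x', ?D b) \<in> \<psi> (T a)" if a: "a \<in> points X" for a
  proof -
    obtain r where r: "r \<in> basis_rels Xh" "(?D a, x) \<in> r"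
      using basis_rel_exists[OF Xh(1) D_in[OF a]] x Xh(2) by metis
    have "\<exists>c. (x', c) \<in> \<psi> (T a) \<and> (c, x') \<in> \<psi> r"
      using path[OF T(1)[OF a] r(1) e x'] T(2)[OF a] r(2) by blast
    then obtain c where c: "(x', c) \<in> \<psi> (T a)" by blast
    then show ?thesis using psiT_diag[OF a c] by (auto simp: diag_def)
  qed
  then obtain f where f: "\<And>a. a \<in> points X \<Longrightarrow> f a \<in> points Y"
      "\<And>a. a \<in> points X \<Longrightarrow> (x', ?D (f a)) \<in> \<psi> (T a)"
    by metis

  have f_rel: "(f a, f b) \<in> \<phi> s" if s: "s \<in> basis_rels X" "(a, b) \<in> s" for a b s
  proof -
    have ab: "a \<in> points X" "b \<in> points X" using subX[OF s(1)] s(2) by auto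
    obtain r where r: "r \<in> basis_rels Xh" "(?D a, ?D b) \<in> r"
      using basis_rel_exists[OF Xh(1) D_in[OF ab(1)] D_in[OF ab(2)]] .
    have "\<exists>c. (x', c) \<in> \<psi> (T a) \<and> (c, ?D (f b)) \<in> \<psi> r"
      using path[OF T(1)[OF ab(1)] r(1) T(1)[OF ab(2)] T(2)[OF ab(2)] f(2)[OF ab(2)]]
        T(2)[OF ab(1)] r(2) by blast
    then have psi_r: "(?D (f a), ?D (f b)) \<in> \<psi> r" using psiT_unique[OF ab(1) _ f(2)[OF ab(1)]] by blast
    have ss: "?D s \<in> tuples m (basis_rels X)" "(?D a, ?D b) \<in> tensor (?D s)"
      using s by (auto simp: tuples_def tensor_def)
    have "r \<subseteq> tensor (?D s)" using basis_rel_subset_tensor[OF extX ss(1) r ss(2)] .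
    then have "\<psi> r \<subseteq> tensor (map \<phi> (?D s))" using tens[OF ss(1)] r(1) by (auto simp: union_ext_def)
    then have "(?D (f a), ?D (f b)) \<in> tensor (map \<phi> (?D s))" using psi_r by blast
    then show ?thesis using m by (auto simp: tensor_def)
  qed

  have f_inj: "inj_on f (points X)"
  proof (rule inj_onI)
    fix a b assume ab: "a \<in> points X" "b \<in> points X" and "f a = f b"
    then have "\<psi> (T a) = \<psi> (T b)"
      using f(2)[OF ab(1)] f(2)[OF ab(2)] basis_rel_unique[OF Yh(1) psiT_in[OF ab(1)] psiT_in[OF ab(2)]] by simp
    then have "T a = T b" using psi T(1)[OF ab(1)] T(1)[OF ab(2)] by (auto simp: bij_betw_def inj_on_def)
    then show "a = b" using T_inj[OF ab] by blast
  qed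
  have "b \<in> f ` points X" if b: "b \<in> points Y" for b
  proof -
    have bd: "?D b \<in> diag m (points Y)" using b by (auto simp: diag_def)
    then have D_b: "?D b \<in> points Yh" using diag_subset_tuples Yh(2) by auto
    obtain t' where t': "t' \<in> basis_rels Yh" "(x', ?D b) \<in> t'"
      using basis_rel_exists[OF Yh(1) x'_in D_b] .
    obtain t where t: "t \<in> basis_rels Xh" "t' = \<psi> t" using psi t' by (auto simp: bij_betw_def)
    have "(?D b, ?D b) \<in> union_ext Xh \<psi> (Id_on (diag m (points X)))" unfolding dg using bd by blast
    then obtain d where d: "d \<in> basis_rels Xh" "d \<subseteq> Id_on (diag m (points X))" "(?D b, ?D b) \<in> \<psi> d"
      by (auto simp: union_ext_def)
    \<comment> \<open>the relation \<open>t\<close> leaves \<open>x\<close> because its image leaves \<open>x'\<close>\<close>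
    have "\<exists>y. (x, y) \<in> t"
    proof -
      obtain s' where s': "s' \<in> basis_rels Yh" "(?D b, x') \<in> s'"
        using basis_rel_exists[OF Yh(1) D_b x'_in] .
      obtain s where s: "s \<in> basis_rels Xh" "s' = \<psi> s" using psi s' by (auto simp: bij_betw_def)
      show ?thesis using path[OF t(1) s(1) e x'] t t' s s' by blast
    qed
    then obtain y where y: "(x, y) \<in> t" by blast
    have "\<exists>c. (x, c) \<in> t \<and> (c, y) \<in> d"
      using path[OF t(1) d(1) t(1) y] t' t d(3) by blast
    then obtain a where a: "a \<in> points X" "(x, ?D a) \<in> t" using d(2) by (auto simp: diag_def)
    then have "T a = t" using basis_rel_unique[OF Xh(1) T(1)[OF a(1)] t(1) T(2)[OF a(1)]] by blast
    then have "?D b = ?D (f a)" using psiT_unique[OF a(1) _ f(2)[OF a(1)]] t t' by blast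
    then show ?thesis using a(1) m by (auto simp: replicate_eq_replicate)
  qed
  then have f_bij: "bij_betw f (points X) (points Y)"
    using f_inj f(1) by (auto simp: bij_betw_def)

  have image: "\<phi> s = rel_image f s" if s: "s \<in> basis_rels X" for s
  proof
    show "rel_image f s \<subseteq> \<phi> s" using f_rel[OF s] by (auto simp: rel_image_def)
    have phi_s: "\<phi> s \<in> basis_rels Y" using phi s by (auto simp: bij_betw_def)
    show "\<phi> s \<subseteq> rel_image f s"
    proof
      fix p assume p: "p \<in> \<phi> s"
      then obtain u v where uv: "p = (u, v)" "u \<in> points Y" "v \<in> points Y"
        using basis_rel_subset[OF Y phi_s] by (cases p) auto
      have "f ` points X = points Y" using f_bij by (simp add: bij_betw_def)
      then obtain a b where ab: "a \<in> points X" "b \<in> points X" "u = f a" "v = f b"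
        using uv by blast
      obtain t where t: "t \<in> basis_rels X" "(a, b) \<in> t" using coverX ab by blast
      have "\<phi> t \<in> basis_rels Y" using phi t by (auto simp: bij_betw_def)
      then have "\<phi> t = \<phi> s"
        using basis_rel_unique[OF Y _ phi_s _ p] f_rel[OF t] uv ab by blast
      then have "t = s" using phi t s by (auto simp: bij_betw_def inj_on_def)
      then show "p \<in> rel_image f s" using t uv ab by (force simp: rel_image_def)
    qed
  qed
  have "rel_image f ` basis_rels X = \<phi> ` basis_rels X" using image by auto
  then have "isomorphism X Y f"
    using f_bij phi by (simp add: isomorphism_def bij_betw_def)
  moreover have "induced_by X \<phi> f" using image by (simp add: induced_by_def)
  ultimately show ?thesis using that by blast
qed


section \<open>The Passman scheme\<close>

text \<open>The product of the coordinate differences. Translations do not change it, and a monomial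
  matrix multiplies it by its determinant up to sign; its square is therefore an invariant of the
  Passman group.\<close>

definition area :: "'k::field ^ 2 \<Rightarrow> 'k ^ 2 \<Rightarrow> 'k" where
  "area u v = (u $ 1 - v $ 1) * (u $ 2 - v $ 2)"

lemma ex1_2_iff: "(\<exists>!j :: 2. P j) \<longleftrightarrow> P 1 \<noteq> P 2"
proof -
  have ex: "(\<exists>j :: 2. Q j) \<longleftrightarrow> Q 1 \<or> Q 2" for Q
    using forall_2[of "\<lambda>j. \<not> Q j"] by blast
  have "(1 :: 2) \<noteq> 2" "(2 :: 2) \<noteq> 1" by simp_all
  then show ?thesis unfolding Ex1_def ex forall_2 by blast
qed

lemma area_monomial:
  fixes A :: "'k::field ^ 2 ^ 2"
  assumes "monomial_matrix A" "det A = 1 \<or> det A = - 1"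
  shows "(area (A *v u) (A *v v))\<^sup>2 = (area u v)\<^sup>2"
proof -
  have diff: "area (A *v u) (A *v v) =
      (A $ 1 $ 1 * (u $ 1 - v $ 1) + A $ 1 $ 2 * (u $ 2 - v $ 2)) *
      (A $ 2 $ 1 * (u $ 1 - v $ 1) + A $ 2 $ 2 * (u $ 2 - v $ 2))"
    by (simp add: area_def matrix_vector_mult_def sum_2 algebra_simps)
  have "(A $ 1 $ 2 = 0 \<and> A $ 2 $ 1 = 0) \<or> (A $ 1 $ 1 = 0 \<and> A $ 2 $ 2 = 0)"
    using assms(1) unfolding monomial_matrix_def ex1_2_iff forall_2 by blast
  then have "area (A *v u) (A *v v) = det A * area u v \<or> area (A *v u) (A *v v) = - det A * area u v"
  proof
    assume "A $ 1 $ 2 = 0 \<and> A $ 2 $ 1 = 0"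
    then show ?thesis unfolding diff by (simp add: det_2 area_def)
  next
    assume "A $ 1 $ 1 = 0 \<and> A $ 2 $ 2 = 0"
    then show ?thesis unfolding diff by (simp add: det_2 area_def)
  qed
  then show ?thesis using assms(2) by (auto simp: power_mult_distrib)
qed

lemma passman_group_invariant:
  fixes g :: "'k::field ^ 2 \<Rightarrow> 'k ^ 2"
  assumes "g \<in> passman_group"
  shows "bij g \<and> (\<forall>u v. (area (g u) (g v))\<^sup>2 = (area u v)\<^sup>2)"
proof -
  let ?B = "BijGroup (UNIV :: ('k ^ 2) set)"
  let ?H = "{g :: 'k ^ 2 \<Rightarrow> 'k ^ 2. bij g \<and> (\<forall>u v. (area (g u) (g v))\<^sup>2 = (area u v)\<^sup>2)}"
  let ?gens = "{\<lambda>x. x + v | v. True} \<union> {\<lambda>x. A *v x | A. monomial_matrix A \<and> (det A = 1 \<or> det A = - 1)}"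
  have Bij: "Bij (UNIV :: ('k ^ 2) set) = {g. bij g}" by (auto simp: Bij_def)
  interpret group ?B by (rule group_BijGroup)
  have inv: "m_inv ?B g = inv_into UNIV g" if "bij g" for g :: "'k ^ 2 \<Rightarrow> 'k ^ 2"
    using inv_BijGroup[of g UNIV] that by (simp add: Bij restrict_def)
  have "subgroup ?H ?B"
  proof (rule subgroupI)
    show "?H \<subseteq> carrier ?B" by (auto simp: BijGroup_def Bij)
    show "?H \<noteq> {}" using bij_id by fastforce
  next
    fix g assume g: "g \<in> ?H"
    have "(area (inv_into UNIV g u) (inv_into UNIV g v))\<^sup>2 = (area u v)\<^sup>2" for u v
    proof -
      have "(area (g (inv_into UNIV g u)) (g (inv_into UNIV g v)))\<^sup>2 = (area (inv_into UNIV g u) (inv_into UNIV g v))\<^sup>2" using g by blast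
      then show ?thesis using g by (simp add: bij_is_surj surj_f_inv_f)
    qed
    then show "m_inv ?B g \<in> ?H" using g inv by (simp add: bij_imp_bij_inv)
  next
    fix g h assume "g \<in> ?H" "h \<in> ?H"
    then show "g \<otimes>\<^bsub>?B\<^esub> h \<in> ?H"
      by (auto simp: BijGroup_def Bij compose_def bij_comp[unfolded comp_def])
  qed
  moreover have "?gens \<subseteq> ?H"
  proof -
    have "bij (\<lambda>x. x + v)" for v :: "'k ^ 2"
      by (rule o_bij[of "\<lambda>x. x - v"]) auto
    moreover have "bij ((*v) A)" if "det A = 1 \<or> det A = - 1" for A :: "'k ^ 2 ^ 2"
      using that by (auto simp: invertible_eq_bij[symmetric] invertible_det_nz)
    moreover have "area (u + w) (v + w) = area u v" for u v w :: "'k ^ 2" by (simp add: area_def)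
    ultimately show ?thesis by (auto simp: area_monomial)
  qed
  ultimately have "passman_group \<subseteq> ?H"
    unfolding passman_group_def by (intro generate_subgroup_incl)
  then show ?thesis using assms by blast
qed

lemma passman_same_rel:
  assumes "same_rel (passman_scheme :: ('k::field ^ 2) config) (u, v) (u', v')"
  shows "(area u v)\<^sup>2 = (area u' v')\<^sup>2" "u = v \<longleftrightarrow> u' = v'"
proof -
  obtain g h a b where gh: "g \<in> passman_group" "h \<in> passman_group"
      "u = g a" "v = g b" "u' = h a" "v' = h b"
    using assms by (auto simp: same_rel_def passman_scheme_def Inv_def)
  note inv = passman_group_invariant[OF gh(1)] passman_group_invariant[OF gh(2)]
  show "(area u v)\<^sup>2 = (area u' v')\<^sup>2" using inv gh by simp
  have "u = v \<longleftrightarrow> a = b" "u' = v' \<longleftrightarrow> a = b" using inv gh by (auto simp: bij_def inj_eq)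
  then show "u = v \<longleftrightarrow> u' = v'" by simp
qed

lemma passman_scheme_cover:
  "\<exists>s\<in>basis_rels (passman_scheme :: ('k::field ^ 2) config). (a, b) \<in> s"
proof -
  have "one (BijGroup UNIV) \<in> (passman_group :: ('k ^ 2 \<Rightarrow> 'k ^ 2) set)"
    unfolding passman_group_def by (rule generate.one)
  then have "(\<lambda>x. x) \<in> (passman_group :: ('k ^ 2 \<Rightarrow> 'k ^ 2) set)" by (simp add: BijGroup_def restrict_def)
  then have "(a, b) \<in> {(g a, g b) | g. g \<in> passman_group}"
    by (intro CollectI exI[of _ "\<lambda>x. x"]) simp
  then show ?thesis unfolding passman_scheme_def Inv_def by auto
qed

lemma two_nonzero_if_odd_card:
  assumes "odd (CARD('k::{field,finite}))"
  shows "(2 :: 'k) \<noteq> 0"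
proof
  assume "(2 :: 'k) = 0"
  then have "of_nat 2 = (0 :: 'k)" by simp
  then have "CHAR('k) dvd 2" by (simp only: of_nat_eq_0_iff_char_dvd)
  moreover have "CHAR('k) \<noteq> 1" by simp
  moreover have "CHAR('k) \<noteq> 0"
    using CHAR_dvd_CARD[where 'a = 'k] by (metis card_eq_0_iff dvd_0_left_iff finite UNIV_not_empty)
  ultimately have "CHAR('k) = 2" by (metis prime_nat_iff two_is_prime_nat)
  then show False using CHAR_dvd_CARD[where 'a = 'k] assms by simp
qed

text \<open>Up to sign, the differences of a field element to \<open>0\<close> and to \<open>1\<close> determine it: the squares
  of these differences differ by \<open>2 * a - 1\<close>.\<close>

lemma eq_if_squares_eq:
  fixes a b :: "'k::field"
  assumes "(2 :: 'k) \<noteq> 0" "a\<^sup>2 = b\<^sup>2" "(a - 1)\<^sup>2 = (b - 1)\<^sup>2"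
  shows "a = b"
proof -
  have "(a - 1)\<^sup>2 = a\<^sup>2 - 2 * a + 1" "(b - 1)\<^sup>2 = b\<^sup>2 - 2 * b + 1"
    by (simp_all add: power2_diff)
  then have "2 * a = 2 * b" using assms(2,3) by auto
  then show ?thesis using assms(1) by auto
qed

text \<open>Coordinates can be read off inside the extension. The fourth vertex \<open>(1, 1)\<close> of the unit
  square is the only point with area zero to \<open>(1, 0)\<close> and \<open>(0, 1)\<close> but not to \<open>0\<close>. A point of an
  axis is recognized by two vanishing areas, and its areas to the two vertices at height one over
  this axis give its differences to \<open>0\<close> and to \<open>1\<close> up to sign. Hence the triple \<open>z\<close> of \<open>(1, 1)\<close>
  and the projections of \<open>d\<close> to the axes can only be answered by itself. The vanishing areas
  between \<open>d\<close> and its projections then carry over to \<open>e\<close>, which has therefore the same coordinates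
  as \<open>d\<close>; for points on the axes this argument is degenerate and equality of points takes over.\<close>

lemma passman_diagonal_separated:
  fixes d e :: "'k::field ^ 2"
  defines "x \<equiv> [vector [0, 0], vector [1, 0], vector [0, 1]] :: ('k ^ 2) list"
  assumes two: "(2 :: 'k) \<noteq> 0" and ext: "extends_power 3 passman_scheme Z"
    and same: "same_rel Z (x, replicate 3 d) (x, replicate 3 e)"
  shows "d = e"
proof -
  have Z: "coherent_configuration Z" "points Z = tuples 3 (UNIV :: ('k ^ 2) set)"
    using ext by (simp_all add: extends_power_iff passman_scheme_def Inv_def)
  have coord: "same_rel passman_scheme (u ! i, v ! j) (u' ! i, v' ! j)"
    if "same_rel Z (u, v) (u', v')" "i < 3" "j < 3" for u v u' v' i j
    using same_rel_coordinates[OF ext passman_scheme_cover _ that] passman_same_rel(2) by blast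
  have area_eq: "(area (u ! i) (v ! j))\<^sup>2 = (area (u' ! i) (v' ! j))\<^sup>2"
    if "same_rel Z (u, v) (u', v')" "i < 3" "j < 3" for u v u' v' i j
    using passman_same_rel(1)[OF coord[OF that]] .
  have pt_eq: "u ! i = v ! j \<longleftrightarrow> u' ! i = v' ! j"
    if "same_rel Z (u, v) (u', v')" "i < 3" "j < 3" for u v u' v' i j
    using passman_same_rel(2)[OF coord[OF that]] .
  have vec2_eqI: "u = vector [a, b]" if "u $ 1 = a" "u $ 2 = b" for u :: "'k ^ 2" and a b
    using that by (simp add: vec_eq_iff forall_2)
  define z :: "('k ^ 2) list" where "z = [vector [1, 1], vector [d $ 1, 0], vector [0, d $ 2]]"
  have "z \<in> points Z" by (simp add: Z(2) z_def tuples_def)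
  then obtain z' where z': "same_rel Z (x, z) (x, z')" "same_rel Z (z, replicate 3 d) (z', replicate 3 e)"
    using same_rel_back_and_forth[OF Z(1) same] by metis
  have "z' \<in> points Z" using z'(1) basis_rel_subset[OF Z(1)] by (auto simp: same_rel_def)
  then obtain p r s where prs: "z' = [p, r, s]"
    unfolding Z(2) tuples_def by (auto simp: numeral_3_eq_3 length_Suc_conv)
  have zz: "same_rel Z (z, z) (z', z')" using same_rel_right[OF Z(1) z'(1)] .

  have p: "p = vector [1, 1]"
  proof (rule vec2_eqI)
    have "(p $ 1 - 1) * p $ 2 = 0" "p $ 1 * (p $ 2 - 1) = 0" "p $ 1 * p $ 2 \<noteq> 0"
      using area_eq[OF z'(1), of 1 0] area_eq[OF z'(1), of 2 0] area_eq[OF z'(1), of 0 0]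
      by (auto simp: x_def z_def prs area_def)
    then show "p $ 1 = 1" "p $ 2 = 1" by auto
  qed
  have r: "r = vector [d $ 1, 0]"
  proof (rule vec2_eqI)
    have "r $ 1 * r $ 2 = 0" "(r $ 1 - 1) * r $ 2 = 0"
      using area_eq[OF z'(1), of 0 1] area_eq[OF z'(1), of 1 1] by (auto simp: x_def z_def prs area_def)
    then have r2: "r $ 2 = 0" by auto
    then show "r $ 2 = 0" by simp
    have "(r $ 1)\<^sup>2 = (d $ 1)\<^sup>2"
      using area_eq[OF z'(1), of 2 1] r2 by (simp add: x_def z_def prs area_def)
    moreover have "(r $ 1 - 1)\<^sup>2 = (d $ 1 - 1)\<^sup>2"
      using area_eq[OF zz, of 1 0] r2 p by (simp add: z_def prs area_def power2_commute[of 1])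
    ultimately show "r $ 1 = d $ 1" using eq_if_squares_eq[OF two] by simp
  qed
  have s: "s = vector [0, d $ 2]"
  proof (rule vec2_eqI)
    have "s $ 1 * s $ 2 = 0" "s $ 1 * (s $ 2 - 1) = 0"
      using area_eq[OF z'(1), of 0 2] area_eq[OF z'(1), of 2 2] by (auto simp: x_def z_def prs area_def)
    then have s1: "s $ 1 = 0" by auto
    then show "s $ 1 = 0" by simp
    have "(s $ 2)\<^sup>2 = (d $ 2)\<^sup>2"
      using area_eq[OF z'(1), of 1 2] s1 by (simp add: x_def z_def prs area_def)
    moreover have "(s $ 2 - 1)\<^sup>2 = (d $ 2 - 1)\<^sup>2"
      using area_eq[OF zz, of 2 0] s1 p by (simp add: z_def prs area_def power2_commute[of 1])
    ultimately show "s $ 2 = d $ 2" using eq_if_squares_eq[OF two] by simp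
  qed
  have "(d $ 1 - e $ 1) * e $ 2 = 0" "e $ 1 * (d $ 2 - e $ 2) = 0"
    using area_eq[OF z'(2), of 1 0] area_eq[OF z'(2), of 2 0] by (auto simp: z_def prs r s area_def)
  then consider "e $ 1 = d $ 1" "e $ 2 = d $ 2" | "e $ 1 = 0" "e $ 2 = 0"
    | "e $ 1 = 0" "d $ 1 = 0" | "e $ 2 = 0" "d $ 2 = 0"
    by auto
  then show ?thesis
  proof cases
    case 1
    then show ?thesis by (simp add: vec_eq_iff forall_2)
  next
    case 2
    then have "e = vector [0, 0]" by (intro vec2_eqI) simp_all
    then show ?thesis using pt_eq[OF same, of 0 0] by (simp add: x_def)
  next
    \<comment> \<open>a point on an axis is an entry of the chosen tuple\<close>
    case 3
    then have "d = vector [0, d $ 2]" by (intro vec2_eqI) simp_all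
    then show ?thesis using pt_eq[OF z'(2), of 2 0] s by (simp add: z_def prs)
  next
    case 4
    then have "d = vector [d $ 1, 0]" by (intro vec2_eqI) simp_all
    then show ?thesis using pt_eq[OF z'(2), of 1 0] r by (simp add: z_def prs)
  qed
qed


theorem theorem1p4:
  fixes q :: nat
  assumes "primepow q" and "odd q" and "CARD('k::{field,finite}) = q"
  shows "separability_number TYPE('b) (passman_scheme :: ('k ^ 2) config) \<le> 3"
proof -
  let ?X = "passman_scheme :: ('k ^ 2) config"
  let ?x = "[vector [0, 0], vector [1, 0], vector [0, 1]] :: ('k ^ 2) list"
  have two: "(2 :: 'k) \<noteq> 0" using two_nonzero_if_odd_card assms(2,3) by blast
  have pts: "points ?X = UNIV" by (simp add: passman_scheme_def Inv_def)
  have fin: "finite (points ?X)" by simp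
  have ext: "extends_power 3 ?X (m_extension 3 ?X)"
    using extends_power_m_extension[OF fin] pts by simp
  have "\<exists>f. isomorphism ?X Y f \<and> induced_by ?X \<phi> f"
    if "coherent_configuration Y" "m_dimensional 3 ?X Y \<phi>" for Y :: "'b config" and \<phi>
  proof (rule induced_if_diagonal_separated[of 3 ?X ?x Y \<phi>])
    show "?x \<in> tuples 3 (points ?X)" by (simp add: tuples_def pts)
    show "a = b" if "same_rel (m_extension 3 ?X) (?x, replicate 3 a) (?x, replicate 3 b)" for a b
      using passman_diagonal_separated[OF two ext that] .
  qed (use that pts passman_scheme_cover in auto)
  then show ?thesis
    unfolding separability_number_def by (intro Least_le) simp
qed
end
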